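(* Let $f$ be the function defined for real $x \ge 0$ by $x + f(x) = \min\{p \text{ prime} : p > x\}$. Assume that $c_1 > 0$ is a constant such that $f(x) \le c_1 \ln x$ for every $x \ge 2$. Then there exists a constant $c_1' > 0$ such that for any sequence of radii $r_n$ with $$r_n \ge \frac{1}{2} + c_1'\sqrt{\frac{\ln n}{n}},$$ there exists $n_0$ such that $\chi(S_{r_n}^{n-1}) > n+1$ for all $n \ge n_0$.
   Context: $S_r^{n-1} = \{x \in \mathbb{R}^n : \|x\|_2 = r\}$ is the Euclidean sphere of radius $r$ in $\mathbb{R}^n$; $\chi(S_r^{n-1})$ is the minimum number of colours needed to colour its points so that any two points at Euclidean distance exactly $1$ receive different colours. *)

theory Defs
  imports
    "HOL-Analysis.Analysis"
    "HOL-Computational_Algebra.Primes"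
    "HOL-Library.Extended_Nat"
begin

text \<open>Since the dimension varies inside the statement, points of $n$-dimensional Euclidean space
  are the elements of \<^term>\<open>topspace (Euclidean_space n)\<close>, i.e. the sequences
  vanishing at every index \<open>i \<ge> n\<close>.\<close>

definition euclid_sphere :: "nat \<Rightarrow> real \<Rightarrow> (nat \<Rightarrow> real) set" where
  "euclid_sphere n r = {x \<in> topspace (Euclidean_space n). L2_set x {..<n} = r}"

definition euclid_dist :: "nat \<Rightarrow> (nat \<Rightarrow> real) \<Rightarrow> (nat \<Rightarrow> real) \<Rightarrow> real" where
  "euclid_dist n x y = L2_set (\<lambda>i. x i - y i) {..<n}"

definition unit_dist_colouring ::
    "nat \<Rightarrow> (nat \<Rightarrow> real) set \<Rightarrow> nat \<Rightarrow> ((nat \<Rightarrow> real) \<Rightarrow> nat) \<Rightarrow> bool" where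
  "unit_dist_colouring n S k c \<longleftrightarrow>
     c ` S \<subseteq> {..<k} \<and> (\<forall>x\<in>S. \<forall>y\<in>S. euclid_dist n x y = 1 \<longrightarrow> c x \<noteq> c y)"

text \<open>The infimum in \<^typ>\<open>enat\<close> is attained whenever a finite colouring exists,
  and is \<open>\<infinity>\<close> otherwise.\<close>

definition unit_dist_chromatic_number :: "nat \<Rightarrow> (nat \<Rightarrow> real) set \<Rightarrow> enat" where
  "unit_dist_chromatic_number n S = (INF k\<in>{k. \<exists>c. unit_dist_colouring n S k c}. enat k)"

definition next_prime_gap :: "real \<Rightarrow> real" where
  "next_prime_gap x = real (LEAST p::nat. prime p \<and> real p > x) - x"

end

theory Submission
  imports Defs "HOL-Probability.Hoeffding" "HOL-Real_Asymp.Real_Asymp"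
begin

text \<open>Put \<open>m = n - 1\<close>. The vertices of the cube \<open>{-s, s}\<^sup>m\<close> with \<open>s = 1 / sqrt (8 p)\<close>, lifted by a
  constant last coordinate, lie on the sphere of radius \<open>r\<close> as soon as \<open>m / (8 p) \<le> r\<^sup>2\<close>, and two
  of them have distance 1 if their Hamming distance is \<open>2 p\<close>. For a prime \<open>p > m / 4\<close> the linear
  algebra method modulo \<open>p\<close> bounds a set of vertices with even Hamming distances, none equal to
  \<open>2 p\<close>, by the number of subsets of size less than \<open>p\<close>. If \<open>p \<le> m / 2 - sqrt (m ln m)\<close>, this is
  at most \<open>2\<^sup>m / m\<^sup>2\<close> by Hoeffding's inequality, so \<open>n + 1\<close> colour classes, each split by parity,
  cannot cover the cube. The gap assumption provides such a prime with
  \<open>p > m / 2 - 2 sqrt (m ln m)\<close>, and then \<open>m / (8 p) \<le> r\<^sup>2\<close> holds with \<open>c\<^sub>1' = 4\<close>.\<close>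

section \<open>Linear algebra modulo a prime\<close>

text \<open>More than \<open>card T\<close> rows would give more than \<open>p ^ card T\<close> coefficient vectors modulo \<open>p\<close>,
  so the pigeonhole principle yields a linear relation, which the diagonal excludes.\<close>

lemma card_le_of_factorization_mod_prime:
  fixes p :: nat and M :: "'a \<Rightarrow> 'a \<Rightarrow> int"
  assumes "prime p" "finite F" "finite T"
    and fac: "\<And>x y. x \<in> F \<Longrightarrow> y \<in> F \<Longrightarrow> M x y = (\<Sum>s\<in>T. a x s * b s y)"
    and diag: "\<And>x. x \<in> F \<Longrightarrow> \<not> int p dvd M x x"
    and off: "\<And>x y. x \<in> F \<Longrightarrow> y \<in> F \<Longrightarrow> x \<noteq> y \<Longrightarrow> int p dvd M x y"
  shows "card F \<le> card T"
proof (rule ccontr)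
  assume "\<not> card F \<le> card T"
  have p1: "p > 1" using \<open>prime p\<close> by (rule prime_gt_1_nat)
  define Z where "Z = {0..<int p}"
  define \<phi> where "\<phi> = (\<lambda>c. \<lambda>s\<in>T. (\<Sum>x\<in>F. c x * a x s) mod int p)"
  let ?A = "F \<rightarrow>\<^sub>E Z" and ?B = "T \<rightarrow>\<^sub>E Z"
  have cZ: "card Z = p" by (simp add: Z_def)
  have "\<phi> ` ?A \<subseteq> ?B"
    using p1 by (auto simp: \<phi>_def Z_def)
  moreover have "finite ?B" using \<open>finite T\<close> by (simp add: Z_def finite_PiE)
  ultimately have "card (\<phi> ` ?A) \<le> card ?B" by (rule card_mono[rotated])
  also have "\<dots> = p ^ card T" using \<open>finite T\<close> by (simp add: card_PiE cZ)
  also have "\<dots> < p ^ card F" using p1 \<open>\<not> card F \<le> card T\<close> by simp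
  also have "\<dots> = card ?A" using \<open>finite F\<close> by (simp add: card_PiE cZ)
  finally have "\<not> inj_on \<phi> ?A" by (rule pigeonhole)
  then obtain c c' where c: "c \<in> ?A" "c' \<in> ?A" "\<phi> c = \<phi> c'" "c \<noteq> c'"
    by (auto simp: inj_on_def)
  then obtain z where z: "z \<in> F" "c z \<noteq> c' z" by (meson PiE_ext)
  \<comment> \<open>The difference of two colliding coefficient vectors is a linear relation modulo
    \<open>p\<close> between the rows of \<open>a\<close>. Its entries are below \<open>p\<close> in
    absolute value, so the one at \<open>z\<close> is nonzero modulo \<open>p\<close>.\<close>
  define e where "e = (\<lambda>x. c x - c' x)"
  have dv: "int p dvd (\<Sum>x\<in>F. e x * a x s)" if "s \<in> T" for s
  proof -
    have "(\<Sum>x\<in>F. c x * a x s) mod int p = (\<Sum>x\<in>F. c' x * a x s) mod int p"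
      using fun_cong[OF c(3), of s] that by (simp add: \<phi>_def)
    then show ?thesis
      by (simp add: mod_eq_dvd_iff e_def sum_subtractf left_diff_distrib)
  qed
  \<comment> \<open>Pairing the relation with column \<open>z\<close> of \<open>b\<close> gives a
    relation between the entries \<open>M x z\<close>, of which only the diagonal one survives
    modulo \<open>p\<close>.\<close>
  have "int p dvd (\<Sum>s\<in>T. (\<Sum>x\<in>F. e x * a x s) * b s z)"
    by (rule dvd_sum, rule dvd_mult2, rule dv)
  also have "(\<Sum>s\<in>T. (\<Sum>x\<in>F. e x * a x s) * b s z) = (\<Sum>x\<in>F. e x * (\<Sum>s\<in>T. a x s * b s z))"
    unfolding sum_distrib_right sum_distrib_left by (subst sum.swap) (simp add: mult.assoc)
  also have "\<dots> = (\<Sum>x\<in>F. e x * M x z)"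
    using fac z(1) by simp
  also have "\<dots> = e z * M z z + (\<Sum>x\<in>F - {z}. e x * M x z)"
    using z(1) \<open>finite F\<close> by (simp add: sum.remove)
  finally have "int p dvd e z * M z z + (\<Sum>x\<in>F - {z}. e x * M x z)" .
  moreover have "int p dvd (\<Sum>x\<in>F - {z}. e x * M x z)"
    using off z(1) by (intro dvd_sum dvd_mult) auto
  ultimately have "int p dvd e z * M z z" by (simp add: dvd_add_left_iff)
  then have "int p dvd e z"
    using \<open>prime p\<close> diag[OF z(1)] by (simp add: prime_dvd_mult_iff)
  moreover have "\<bar>e z\<bar> < int p" "e z \<noteq> 0"
    using c(1,2) z by (auto simp: e_def Z_def PiE_iff) fastforce
  ultimately show False using zdvd_not_zless[of "\<bar>e z\<bar>" "int p"] by simp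
qed

section \<open>Multilinear polynomials on subsets\<close>

text \<open>Functions of \<open>Y\<close>, in terms of its indicator vector, that are multilinear polynomials
  of degree at most \<open>k\<close> in the coordinates from \<open>V\<close>.\<close>

definition multilinear_le :: "'a set \<Rightarrow> nat \<Rightarrow> ('a set \<Rightarrow> int) \<Rightarrow> bool" where
  "multilinear_le V k f \<longleftrightarrow>
     (\<exists>a. \<forall>Y. f Y = (\<Sum>S | S \<subseteq> V \<and> card S \<le> k. a S * of_bool (S \<subseteq> Y)))"

lemma multilinear_le_add:
  assumes "multilinear_le V k f" "multilinear_le V k g"
  shows "multilinear_le V k (\<lambda>Y. f Y + g Y)"
proof -
  from assms obtain a b where
    "\<And>Y. f Y = (\<Sum>S | S \<subseteq> V \<and> card S \<le> k. a S * of_bool (S \<subseteq> Y))"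
    "\<And>Y. g Y = (\<Sum>S | S \<subseteq> V \<and> card S \<le> k. b S * of_bool (S \<subseteq> Y))"
    unfolding multilinear_le_def by blast
  then show ?thesis
    unfolding multilinear_le_def
    by (intro exI[of _ "\<lambda>S. a S + b S"]) (simp add: sum.distrib distrib_right)
qed

lemma multilinear_le_cmult:
  assumes "multilinear_le V k f"
  shows "multilinear_le V k (\<lambda>Y. c * f Y)"
proof -
  from assms obtain a where
    "\<And>Y. f Y = (\<Sum>S | S \<subseteq> V \<and> card S \<le> k. a S * of_bool (S \<subseteq> Y))"
    unfolding multilinear_le_def by blast
  then show ?thesis
    unfolding multilinear_le_def
    by (intro exI[of _ "\<lambda>S. c * a S"]) (simp add: sum_distrib_left mult.assoc)
qed

lemma multilinear_le_monomial:
  assumes "finite V" "S \<subseteq> V" "card S \<le> k"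
  shows "multilinear_le V k (\<lambda>Y. of_bool (S \<subseteq> Y))"
  unfolding multilinear_le_def
proof (intro exI allI)
  fix Y
  have "(\<Sum>S' | S' \<subseteq> V \<and> card S' \<le> k. of_bool (S' = S) * of_bool (S' \<subseteq> Y))
      = (\<Sum>S' | S' \<subseteq> V \<and> card S' \<le> k. if S' = S then of_bool (S \<subseteq> Y) else (0::int))"
    by (intro sum.cong) auto
  also have "\<dots> = of_bool (S \<subseteq> Y)" using assms by (simp add: sum.delta')
  finally show "of_bool (S \<subseteq> Y) =
      (\<Sum>S' | S' \<subseteq> V \<and> card S' \<le> k. of_bool (S' = S) * of_bool (S' \<subseteq> Y) :: int)" ..
qed

lemma multilinear_le_sum:
  assumes "finite V" "\<And>i. i \<in> I \<Longrightarrow> multilinear_le V k (f i)"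
  shows "multilinear_le V k (\<lambda>Y. \<Sum>i\<in>I. f i Y)"
proof -
  have zero: "multilinear_le V k (\<lambda>Y. 0)"
    unfolding multilinear_le_def by (rule exI[of _ "\<lambda>_. 0"]) simp
  show ?thesis
    using assms(2)
    by (induction I rule: infinite_finite_induct) (simp_all add: zero multilinear_le_add)
qed

text \<open>Indicators are idempotent, so the monomial of \<open>S\<close> times the coordinate
  \<open>j\<close> is the monomial of \<open>insert j S\<close>: the product stays multilinear and
  the degree grows by at most one.\<close>

lemma multilinear_le_mult_affine:
  assumes "finite V" "multilinear_le V k f"
  shows "multilinear_le V (Suc k) (\<lambda>Y. f Y * (c + (\<Sum>j\<in>V. b j * of_bool (j \<in> Y))))"
proof -
  let ?T = "{S. S \<subseteq> V \<and> card S \<le> k}"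
  from assms(2) obtain a where a: "\<And>Y. f Y = (\<Sum>S\<in>?T. a S * of_bool (S \<subseteq> Y))"
    unfolding multilinear_le_def by blast
  have *: "f Y * (c + (\<Sum>j\<in>V. b j * of_bool (j \<in> Y))) =
      (\<Sum>S\<in>?T. (c * a S) * of_bool (S \<subseteq> Y)) +
      (\<Sum>S\<in>?T. \<Sum>j\<in>V. (a S * b j) * of_bool (insert j S \<subseteq> Y))" for Y
  proof -
    have "(\<Sum>S\<in>?T. \<Sum>j\<in>V. (a S * b j) * of_bool (insert j S \<subseteq> Y)) =
        (\<Sum>S\<in>?T. \<Sum>j\<in>V. (a S * of_bool (S \<subseteq> Y)) * (b j * of_bool (j \<in> Y)))"
      by (intro sum.cong) auto
    then show ?thesis
      unfolding a distrib_left sum_product by (simp add: sum_distrib_left sum_distrib_right mult_ac)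
  qed
  show ?thesis
    unfolding *
  proof (intro multilinear_le_add multilinear_le_sum multilinear_le_cmult
      multilinear_le_monomial assms(1))
    fix S j assume "S \<in> ?T" "j \<in> V"
    then show "insert j S \<subseteq> V" "card (insert j S) \<le> Suc k"
      using card_insert_le_m1[of "Suc k" S j] by auto
  qed auto
qed

lemma multilinear_le_prod_affine:
  assumes "finite V"
  shows "multilinear_le V k (\<lambda>Y. \<Prod>i=1..k. c i + (\<Sum>j\<in>V. b j * of_bool (j \<in> Y)))"
proof (induction k)
  case 0
  then show ?case using multilinear_le_monomial[OF assms, of "{}" 0] by simp
next
  case (Suc k)
  from multilinear_le_mult_affine[OF assms Suc.IH] show ?case by simp
qed

section \<open>Families of sets with a forbidden distance\<close>

text \<open>The indicator of a symmetric difference is x + y - 2xy, which is affine in y for fixed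
  \<open>X\<close>. This makes every factor of the polynomials below an affine form.\<close>

lemma card_sym_diff_affine:
  assumes "finite V" "X \<subseteq> V" "Y \<subseteq> V"
  shows "int (card (sym_diff X Y)) =
    int (card X) + (\<Sum>j\<in>V. (1 - 2 * of_bool (j \<in> X)) * of_bool (j \<in> Y))"
proof -
  have ind: "int (card Z) = (\<Sum>j\<in>V. of_bool (j \<in> Z))" if "Z \<subseteq> V" for Z
    using assms(1) that by (simp add: of_bool_def sum.If_cases Int_absorb1)
  have "sym_diff X Y \<subseteq> V" using assms by auto
  from ind[OF this] ind[OF assms(2)] show ?thesis
    by (simp flip: sum.distrib) (intro sum.cong, auto)
qed

text \<open>The Frankl--Wilson argument. The polynomials \<open>\<Prod>i=1..p-1. |X \<triangle> Y| - 2i\<close>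
  detect modulo \<open>p\<close> whether half of the distance is divisible by \<open>p\<close>.\<close>

lemma card_even_family_avoiding_distance:
  fixes p :: nat
  assumes "prime p" "p \<noteq> 2" "finite V" "card V < 4 * p" "F \<subseteq> Pow V"
    and even: "\<And>X Y. X \<in> F \<Longrightarrow> Y \<in> F \<Longrightarrow> even (card (sym_diff X Y))"
    and avoid: "\<And>X Y. X \<in> F \<Longrightarrow> Y \<in> F \<Longrightarrow> card (sym_diff X Y) \<noteq> 2 * p"
  shows "card F \<le> card {S. S \<subseteq> V \<and> card S \<le> p - 1}"
proof -
  define M where "M X Y = (\<Prod>i=1..p-1. int (card (sym_diff X Y)) - 2 * int i)" for X Y :: "'a set"
  \<comment> \<open>Used on the diagonal, where every factor of \<open>M X X\<close> equals
    \<open>- 2 * int i\<close> with 0 < i < p.\<close>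
  have p: "\<not> int p dvd 2"
    using primes_dvd_imp_eq[OF \<open>prime p\<close> two_is_prime_nat] \<open>p \<noteq> 2\<close> int_dvd_int_iff[of p 2] by auto
  have "\<exists>a. \<forall>Y\<in>F. M X Y = (\<Sum>S | S \<subseteq> V \<and> card S \<le> p - 1. a S * of_bool (S \<subseteq> Y))"
    if "X \<in> F" for X
  proof -
    have "M X Y = (\<Prod>i=1..p-1. (int (card X) - 2 * int i) +
        (\<Sum>j\<in>V. (1 - 2 * of_bool (j \<in> X)) * of_bool (j \<in> Y)))" if "Y \<in> F" for Y
      unfolding M_def using that \<open>X \<in> F\<close> assms(3,5) card_sym_diff_affine[of V X Y]
      by (intro prod.cong) auto
    with multilinear_le_prod_affine[OF assms(3), of "p-1" "\<lambda>i. int (card X) - 2 * int i"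
        "\<lambda>j. 1 - 2 * of_bool (j \<in> X)"]
    show ?thesis unfolding multilinear_le_def by auto
  qed
  then obtain a where a: "\<And>X Y. X \<in> F \<Longrightarrow> Y \<in> F \<Longrightarrow>
      M X Y = (\<Sum>S | S \<subseteq> V \<and> card S \<le> p - 1. a X S * of_bool (S \<subseteq> Y))"
    by metis
  show ?thesis
  proof (rule card_le_of_factorization_mod_prime[OF \<open>prime p\<close> _ _ a])
    show "finite F" using assms(3,5) by (meson finite_Pow_iff finite_subset)
    show "finite {S. S \<subseteq> V \<and> card S \<le> p - 1}" using assms(3) by simp
    show "\<not> int p dvd M X X" for X
    proof
      assume "int p dvd M X X"
      then obtain i where i: "i \<in> {1..p-1}" "int p dvd 2 * int i"
        using \<open>prime p\<close> by (auto simp: M_def prime_dvd_prod_iff)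
      then have "p dvd i"
        using \<open>prime p\<close> p by (simp add: prime_dvd_mult_iff)
      with i(1) show False by (auto dest!: dvd_imp_le)
    qed
    show "int p dvd M X Y" if "X \<in> F" "Y \<in> F" "X \<noteq> Y" for X Y
    proof -
      have sub: "sym_diff X Y \<subseteq> V" using that assms(5) by auto
      have "even (card (sym_diff X Y))" using even that by blast
      then obtain e where e: "card (sym_diff X Y) = 2 * e" by (elim evenE)
      \<comment> \<open>Half the distance lies strictly between 0 and 2p, where the only multiple of
        p is p itself, excluded by \<open>avoid\<close>. So the residue \<open>i\<close> of
        \<open>e\<close> indexes a factor of \<open>M X Y\<close> divisible by p.\<close>
      have "e \<noteq> 0"
        using e that sub finite_subset[OF sub assms(3)] by auto
      moreover have "e < 2 * p" using card_mono[OF assms(3) sub] e assms(4) by linarith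
      moreover have "e \<noteq> p" using avoid that e by metis
      ultimately have nd: "\<not> p dvd e"
        by (auto simp: dvd_def less_2_cases_iff)
      define i where "i = e mod p"
      have "i < p" "i \<noteq> 0"
        using nd prime_gt_0_nat[OF \<open>prime p\<close>] by (simp_all add: i_def dvd_eq_mod_eq_0)
      then have i: "i \<in> {1..p-1}" by auto
      have "int p dvd int e - int i"
        unfolding i_def of_nat_mod by (rule dvd_minus_mod)
      then have "int p dvd int (card (sym_diff X Y)) - 2 * int i"
        unfolding e using dvd_mult[of "int p" "int e - int i" 2] by (simp add: right_diff_distrib)
      then show ?thesis
        unfolding M_def using i by (rule dvd_trans[OF _ dvd_prodI[OF finite_atLeastAtMost]])
    qed
  qed
qed

section \<open>Counting small sets and covering the cube\<close>

text \<open>Divided by 2^m, the count is a lower tail probability of the binomial distribution with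
  parameters m and 1/2, so Hoeffding's inequality applies.\<close>

lemma card_small_subsets_le:
  fixes t :: real
  assumes "finite V" "card V = m" "m > 0" "t \<ge> 0" "real k \<le> real m / 2 - t"
  shows "real (card {S. S \<subseteq> V \<and> card S \<le> k}) \<le> 2 ^ m * exp (- 2 * t\<^sup>2 / real m)"
proof -
  interpret binomial_distribution m "1/2" by unfold_locales simp
  have "{S. S \<subseteq> V \<and> card S \<le> k} = (\<Union>i\<le>k. {S. S \<subseteq> V \<and> card S = i})" by auto
  also have "card \<dots> = (\<Sum>i\<le>k. card {S. S \<subseteq> V \<and> card S = i})"
    using assms(1) by (intro card_UN_disjoint) auto
  finally have "real (card {S. S \<subseteq> V \<and> card S \<le> k}) = (\<Sum>i\<le>k. real (m choose i))"
    using assms(1,2) by (simp add: n_subsets)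
  also have "\<dots> = (\<Sum>i\<le>k. 2 ^ m * pmf (binomial_pmf m (1/2)) i)"
  proof (intro sum.cong refl)
    fix i assume "i \<in> {..k}"
    then have "i \<le> m" using assms(4,5) by simp
    then show "real (m choose i) = 2 ^ m * pmf (binomial_pmf m (1/2)) i"
      by (simp add: power_one_over field_simps flip: power_add)
  qed
  also have "\<dots> = 2 ^ m * measure_pmf.prob (binomial_pmf m (1/2)) {..k}"
    by (simp add: measure_measure_pmf_finite sum_distrib_left)
  also have "\<dots> \<le> 2 ^ m * measure_pmf.prob (binomial_pmf m (1/2)) {x. real x \<le> real m * (1/2) - t}"
    using assms(5) by (intro mult_left_mono measure_pmf.finite_measure_mono) auto
  also have "\<dots> \<le> 2 ^ m * exp (- 2 * t\<^sup>2 / real m)"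
    using prob_le[OF assms(3,4)] by (intro mult_left_mono) auto
  finally show ?thesis .
qed

text \<open>Splitting the colour classes by parity turns all distances inside a class even.\<close>

lemma cube_colouring_lower_bound:
  fixes p :: nat and g :: "'a set \<Rightarrow> nat"
  assumes "prime p" "p \<noteq> 2" "finite V" "card V < 4 * p"
    and g: "g ` Pow V \<subseteq> {..<k}"
    and proper: "\<And>X Y. X \<subseteq> V \<Longrightarrow> Y \<subseteq> V \<Longrightarrow> card (sym_diff X Y) = 2 * p \<Longrightarrow> g X \<noteq> g Y"
  shows "2 ^ card V \<le> 2 * k * card {S. S \<subseteq> V \<and> card S \<le> p - 1}"
proof -
  define h where "h X = (g X, even (card X))" for X
  define C where "C v = {X \<in> Pow V. h X = v}" for v
  let ?N = "card {S. S \<subseteq> V \<and> card S \<le> p - 1}"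
  have "card (C v) \<le> ?N" for v
  proof (rule card_even_family_avoiding_distance[OF assms(1-4)])
    fix X Y assume XY: "X \<in> C v" "Y \<in> C v"
    then have fin: "finite X" "finite Y" using assms(3) by (auto simp: C_def intro: finite_subset)
    \<comment> \<open>The decompositions amount to |X| + |Y| = |X \<triangle> Y| + 2 |X \<inter> Y|,
      so equal parities force an even distance.\<close>
    have "card (sym_diff X Y) = card (X - Y) + card (Y - X)"
      using fin by (intro card_Un_disjoint) auto
    moreover have "card X = card (X \<inter> Y) + card (X - Y)" "card Y = card (X \<inter> Y) + card (Y - X)"
      using card_Int_Diff[OF fin(1), of Y] card_Int_Diff[OF fin(2), of X]
      by (simp_all only: Int_commute)
    moreover have "even (card X) = even (card Y)"
      using XY by (auto simp: C_def h_def)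
    ultimately show "even (card (sym_diff X Y))"
      by (metis even_add)
    show "card (sym_diff X Y) \<noteq> 2 * p"
      using XY proper[of X Y] by (auto simp: C_def h_def)
  qed (auto simp: C_def)
  then have "(\<Sum>v\<in>{..<k} \<times> UNIV. card (C v)) \<le> card ({..<k} \<times> (UNIV :: bool set)) * ?N"
    using sum_bounded_above[of "{..<k} \<times> UNIV" "\<lambda>v. card (C v)" ?N] by simp
  moreover have "Pow V = (\<Union>v\<in>{..<k} \<times> UNIV. C v)"
    using g by (auto simp: C_def h_def)
  then have "card (Pow V) \<le> (\<Sum>v\<in>{..<k} \<times> UNIV. card (C v))"
    by (simp only:) (intro card_UN_le, simp)
  ultimately show ?thesis
    using assms(3) by (simp add: card_Pow card_cartesian_product)
qed

section \<open>From the cube to the sphere\<close>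

lemma cube_point_on_sphere:
  fixes m p :: nat and r :: real
  assumes "p > 0" "r > 0" "real m / (8 * real p) \<le> r\<^sup>2"
  obtains P where "\<And>X. P X \<in> euclid_sphere (Suc m) r"
    "\<And>X Y. X \<subseteq> {..<m} \<Longrightarrow> Y \<subseteq> {..<m} \<Longrightarrow> card (sym_diff X Y) = 2 * p \<Longrightarrow>
       euclid_dist (Suc m) (P X) (P Y) = 1"
proof
  \<comment> \<open>Each flipped coordinate adds \<open>(2 * s)\<^sup>2\<close> = 1/(2p) to the
    squared distance, so 2p flips give 1. The cube coordinates use up m/(8p) of the squared norm and
    \<open>h\<close> supplies the rest.\<close>
  define s where "s = 1 / sqrt (8 * real p)"
  define h where "h = sqrt (r\<^sup>2 - real m / (8 * real p))"
  define P where "P X i = (if i < m then if i \<in> X then s else - s else if i = m then h else 0)"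
    for X and i :: nat
  have s2: "s\<^sup>2 = 1 / (8 * real p)" by (simp add: s_def power_divide)
  have h2: "h\<^sup>2 = r\<^sup>2 - real m / (8 * real p)" using assms(3) by (simp add: h_def)
  show "P X \<in> euclid_sphere (Suc m) r" for X
  proof -
    have "(\<Sum>i<m. (P X i)\<^sup>2) = (\<Sum>i<m. s\<^sup>2)"
      by (intro sum.cong) (auto simp: P_def)
    then have "(\<Sum>i<Suc m. (P X i)\<^sup>2) = r\<^sup>2"
      by (simp add: s2 P_def h2)
    then show ?thesis
      using assms(2) by (simp add: euclid_sphere_def topspace_Euclidean_space L2_set_def P_def)
  qed
  show "euclid_dist (Suc m) (P X) (P Y) = 1"
    if "X \<subseteq> {..<m}" "Y \<subseteq> {..<m}" "card (sym_diff X Y) = 2 * p" for X Y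
  proof -
    have sub: "sym_diff X Y \<subseteq> {..<m}" using that by auto
    have "(\<Sum>i<Suc m. (P X i - P Y i)\<^sup>2) = (\<Sum>i<m. (P X i - P Y i)\<^sup>2)"
      by (simp add: P_def)
    also have "\<dots> = (\<Sum>i<m. if i \<in> sym_diff X Y then 4 * s\<^sup>2 else 0)"
      by (intro sum.cong) (auto simp: P_def power2_eq_square)
    also have "\<dots> = real (card (sym_diff X Y)) * (4 * s\<^sup>2)"
      using sub by (simp flip: sum.inter_restrict add: Int_absorb1 del: Un_iff Diff_iff)
    also have "\<dots> = 1" using that(3) assms(1) by (simp add: s2)
    finally show ?thesis by (simp add: euclid_dist_def L2_set_def)
  qed
qed

text \<open>Keeps the asymptotics out: \<open>p\<close>, \<open>t\<close> and \<open>k\<close> are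
  free, and the last assumption says that \<open>2 * k\<close> families of the admissible size
  cannot cover the 2^m vertices.\<close>

lemma sphere_chromatic_number_greater:
  fixes m p k :: nat and r t :: real
  assumes "prime p" "p \<noteq> 2" "m < 4 * p" "m > 0" "r > 0" "real m / (8 * real p) \<le> r\<^sup>2"
    and "t \<ge> 0" "real p \<le> real m / 2 - t" "2 * real k * exp (- 2 * t\<^sup>2 / real m) < 1"
  shows "unit_dist_chromatic_number (Suc m) (euclid_sphere (Suc m) r) > enat k"
proof -
  obtain P where P: "\<And>X. P X \<in> euclid_sphere (Suc m) r"
    "\<And>X Y. X \<subseteq> {..<m} \<Longrightarrow> Y \<subseteq> {..<m} \<Longrightarrow> card (sym_diff X Y) = 2 * p \<Longrightarrow>
       euclid_dist (Suc m) (P X) (P Y) = 1"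
    using cube_point_on_sphere[OF prime_gt_0_nat[OF assms(1)] assms(5,6)] by metis
  have "k < l" if "unit_dist_colouring (Suc m) (euclid_sphere (Suc m) r) l c" for l c
  proof (rule ccontr)
    assume "\<not> k < l"
    let ?N = "card {S. S \<subseteq> {..<m} \<and> card S \<le> p - 1}"
    have "2 ^ card {..<m} \<le> 2 * l * ?N"
    proof (rule cube_colouring_lower_bound)
      show "(\<lambda>X. c (P X)) ` Pow {..<m} \<subseteq> {..<l}"
        using that P(1) by (auto simp: unit_dist_colouring_def)
      show "c (P X) \<noteq> c (P Y)"
        if "X \<subseteq> {..<m}" "Y \<subseteq> {..<m}" "card (sym_diff X Y) = 2 * p" for X Y
        using \<open>unit_dist_colouring _ _ _ _\<close> P that by (simp add: unit_dist_colouring_def)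
    qed (use assms in auto)
    also have "\<dots> \<le> 2 * k * ?N" using \<open>\<not> k < l\<close> by simp
    finally have "real (2 ^ m) \<le> real (2 * k * ?N)"
      by (simp only: card_lessThan of_nat_le_iff)
    then have "(2::real) ^ m \<le> real (2 * k * ?N)" by simp
    also have "\<dots> \<le> 2 * real k * (2 ^ m * exp (- 2 * t\<^sup>2 / real m))"
      using card_small_subsets_le[of "{..<m}" m t "p - 1"] assms
      by (auto simp: mult_left_mono)
    also have "\<dots> = 2 ^ m * (2 * real k * exp (- 2 * t\<^sup>2 / real m))" by simp
    also have "\<dots> < 2 ^ m * 1" using assms(9) by (intro mult_strict_left_mono) auto
    finally show False by simp
  qed
  \<comment> \<open>Strict bounds do not pass to infima in general, hence the successor. If no
    finite colouring existed, the infimum would be \<infinity> and the bound would still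
    hold.\<close>
  then have "enat (Suc k) \<le> unit_dist_chromatic_number (Suc m) (euclid_sphere (Suc m) r)"
    unfolding unit_dist_chromatic_number_def by (intro INF_greatest) (auto simp: Suc_le_eq)
  then show ?thesis by (metis enat_ord_simps(2) lessI order_less_le_trans)
qed

section \<open>Choice of the prime and asymptotics\<close>

lemma prime_between_next_prime_gap:
  assumes "x \<ge> 2" "next_prime_gap x \<le> d"
  obtains p :: nat where "prime p" "real p > x" "real p \<le> x + d"
proof -
  \<comment> \<open>The infinitude of primes makes the \<open>LEAST\<close> in
    \<open>next_prime_gap\<close> an actual prime.\<close>
  have "\<exists>p::nat. prime p \<and> real p > x"
    using bigger_prime by (metis of_nat_less_iff order_less_trans reals_Archimedean2)
  then have "prime (LEAST p::nat. prime p \<and> real p > x) \<and> real (LEAST p::nat. prime p \<and> real p > x) > x"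
    by (rule LeastI_ex)
  with assms(2) show thesis
    by (intro that[of "LEAST p::nat. prime p \<and> real p > x"]) (simp_all add: next_prime_gap_def)
qed

theorem theorem7:
  fixes c\<^sub>1 :: real
  assumes "c\<^sub>1 > 0"
    and "\<forall>x::real. x \<ge> 2 \<longrightarrow> next_prime_gap x \<le> c\<^sub>1 * ln x"
  shows "\<exists>c\<^sub>1'::real. c\<^sub>1' > 0 \<and>
    (\<forall>r :: nat \<Rightarrow> real.
      (\<forall>n\<ge>1. r n \<ge> 1/2 + c\<^sub>1' * sqrt (ln (real n) / real n)) \<longrightarrow>
      (\<exists>n\<^sub>0. \<forall>n\<ge>n\<^sub>0.
         unit_dist_chromatic_number n (euclid_sphere n (r n)) > enat (n + 1)))"
proof (intro exI[of _ "4::real"] conjI allI impI)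
  fix r :: "nat \<Rightarrow> real"
  assume r: "\<forall>n\<ge>1. r n \<ge> 1/2 + 4 * sqrt (ln (real n) / real n)"
  \<comment> \<open>With this \<open>t\<close> the exponential in Hoeffding's bound is exactly
    m^(-2), which beats a number of colours linear in m. The second copy of \<open>t m\<close> in
    \<open>x\<close> leaves room for the prime gap, since \<open>ln (x m)\<close> is of smaller
    order than \<open>t m\<close>.\<close>
  define t where "t m = sqrt (real m * ln (real m))" for m :: nat
  define x where "x m = real m / 2 - 2 * t m" for m :: nat
  have "\<forall>\<^sub>F m in sequentially. x m \<ge> 2" unfolding x_def t_def by real_asymp
  moreover have "\<forall>\<^sub>F m in sequentially. x m > real m / 4" unfolding x_def t_def by real_asymp
  moreover have "\<forall>\<^sub>F m in sequentially. x m + c\<^sub>1 * ln (x m) \<le> real m / 2 - t m"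
    unfolding x_def t_def using assms(1) by real_asymp
  \<comment> \<open>With d = sqrt (ln m / m) the left side is 1/(4(1 - 4d)) = 1/4 + d + O(d^2), so
    there is room to spare. The summand with coefficient 4 on the right is the cross term in the
    square of the lower bound on the radius.\<close>
  moreover have "\<forall>\<^sub>F m in sequentially.
      real m / (8 * x m) \<le> 1/4 + 4 * sqrt (ln (real (Suc m)) / real (Suc m))"
    unfolding x_def t_def by real_asymp
  \<comment> \<open>Here \<open>m + 2\<close> is n + 1 for n = m + 1, the number of colours to be
    excluded, doubled by the parity split.\<close>
  moreover have "\<forall>\<^sub>F m in sequentially. 2 * real (m + 2) / (real m)\<^sup>2 < 1" by real_asymp
  ultimately have "\<forall>\<^sub>F m in sequentially.
    unit_dist_chromatic_number (Suc m) (euclid_sphere (Suc m) (r (Suc m))) > enat (Suc m + 1)"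
    using eventually_gt_at_top[of 0]
  proof eventually_elim
    case (elim m)
    obtain p where p: "prime p" "real p > x m" "real p \<le> x m + c\<^sub>1 * ln (x m)"
      using prime_between_next_prime_gap[of "x m"] assms(2) elim(1) by metis
    have rn: "r (Suc m) \<ge> 1/2 + 4 * sqrt (ln (real (Suc m)) / real (Suc m))"
      using r[rule_format, of "Suc m"] by simp
    have pos: "1/2 + 4 * sqrt (ln (real (Suc m)) / real (Suc m)) > 0"
      by (intro add_pos_nonneg) auto
    have t0: "t m \<ge> 0" and "(t m)\<^sup>2 = real m * ln (real m)"
      using elim(6) by (auto simp: t_def)
    then have "exp (- 2 * (t m)\<^sup>2 / real m) = exp (- (2 * ln (real m)))"
      using elim(6) by simp
    also have "\<dots> = 1 / (real m)\<^sup>2"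
      using elim(6) exp_of_nat_mult[of 2 "ln (real m)"] by (simp add: exp_minus inverse_eq_divide)
    finally have ex: "exp (- 2 * (t m)\<^sup>2 / real m) = 1 / (real m)\<^sup>2" .
    show ?case
    proof (rule sphere_chromatic_number_greater[OF p(1)])
      show "p \<noteq> 2" using p(2) elim(1) by auto
      show "m < 4 * p" using p(2) elim(2) by linarith
      show "m > 0" by fact
      show "r (Suc m) > 0" using rn pos by linarith
      have "real m / (8 * real p) \<le> real m / (8 * x m)"
        using p(2) elim(1) by (intro divide_left_mono) auto
      also have "\<dots> \<le> 1/4 + 4 * sqrt (ln (real (Suc m)) / real (Suc m))" by fact
      also have "\<dots> \<le> (1/2 + 4 * sqrt (ln (real (Suc m)) / real (Suc m)))\<^sup>2"
        unfolding power2_sum by (simp add: power2_eq_square)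
      also have "\<dots> \<le> (r (Suc m))\<^sup>2"
        using rn pos by (intro power_mono) auto
      finally show "real m / (8 * real p) \<le> (r (Suc m))\<^sup>2" .
      show "t m \<ge> 0" by fact
      show "real p \<le> real m / 2 - t m" using p(3) elim(3) by linarith
      show "2 * real (Suc m + 1) * exp (- 2 * (t m)\<^sup>2 / real m) < 1"
        unfolding ex using elim(5) by simp
    qed
  qed
  then obtain m\<^sub>0 where m\<^sub>0: "\<And>m. m \<ge> m\<^sub>0 \<Longrightarrow>
    unit_dist_chromatic_number (Suc m) (euclid_sphere (Suc m) (r (Suc m))) > enat (Suc m + 1)"
    by (auto simp: eventually_sequentially)
  show "\<exists>n\<^sub>0. \<forall>n\<ge>n\<^sub>0. unit_dist_chromatic_number n (euclid_sphere n (r n)) > enat (n + 1)"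
    using m\<^sub>0 by (intro exI[of _ "Suc m\<^sub>0"]) (metis Suc_le_D Suc_le_mono)
qed simp

end
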